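(* Let $(X,d)$ be an ultrametric space. Then $(X,d)$ is locally finite if and only if $(\bar{\mathbf{B}}_X, d_H)$ is locally finite.
   Context: Metric spaces are nonempty. An ultrametric space is a metric space $(X,d)$ with $d(x,y)\le\max\{d(x,z),d(z,y)\}$ for all $x,y,z\in X$. For $c\in X$ and $r\ge 0$ the closed ball is $\bar B_r(c)=\{x\in X: d(c,x)\le r\}$ (so $\bar B_0(c)=\{c\}$). $\bar{\mathbf{B}}_X$ is the set of all closed balls $\bar B_r(c)$, $c\in X$, $r\ge 0$, regarded as subsets of $X$. The Hausdorff distance between nonempty closed bounded sets $A,B\subseteq X$ is $d_H(A,B)=\max\{\sup_{a\in A}\inf_{b\in B}d(a,b),\ \sup_{b\in B}\inf_{a\in A}d(a,b)\}$; $\bar{\mathbf{B}}_X$ is equipped with the metric $d_H$. A metric space is called locally finite if every bounded subset of it (i.e. every subset of finite diameter) is finite. *)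

theory Defs
  imports "HOL-Analysis.Analysis"
begin

locale Ultrametric_space = Metric_space +
  assumes nonempty: "M \<noteq> {}"
    and ultrametric: "\<And>x y z. \<lbrakk>x \<in> M; y \<in> M; z \<in> M\<rbrakk> \<Longrightarrow> d x y \<le> max (d x z) (d z y)"

text \<open>Balls are taken as subsets of \<open>M\<close>: equal balls with different centres or radii are identified.\<close>

definition closed_balls :: "'a set \<Rightarrow> ('a \<Rightarrow> 'a \<Rightarrow> real) \<Rightarrow> 'a set set" where
  "closed_balls M d = {Metric_space.mcball M d c r | c r. c \<in> M \<and> 0 \<le> r}"

text \<open>
  Real-valued suprema and infima are only meaningful for nonempty sets that are bounded on the
  relevant side; they are when \<open>A\<close> and \<open>B\<close> are nonempty and bounded, as the members of
  \<open>closed_balls M d\<close> are (see the lemmas below).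
\<close>

definition hausdorff_mdist :: "('a \<Rightarrow> 'a \<Rightarrow> real) \<Rightarrow> 'a set \<Rightarrow> 'a set \<Rightarrow> real" where
  "hausdorff_mdist d A B =
     max (SUP a\<in>A. INF b\<in>B. d a b) (SUP b\<in>B. INF a\<in>A. d a b)"

text \<open>
  Bounded means of finite diameter. This is spelled out because the library's \<open>mbounded\<close> is
  defined by containment in a ball, and because \<open>hausdorff_mdist d\<close> is nonnegative only on suitable
  sets, whereas \<open>Metric_space\<close> requires nonnegativity on the whole type.
\<close>

definition mlocally_finite :: "'a set \<Rightarrow> ('a \<Rightarrow> 'a \<Rightarrow> real) \<Rightarrow> bool" where
  "mlocally_finite M d \<longleftrightarrow>
     (\<forall>S. S \<subseteq> M \<and> (\<exists>D. \<forall>x\<in>S. \<forall>y\<in>S. d x y \<le> D) \<longrightarrow> finite S)"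

lemma (in Metric_space) mlocally_finite_iff_mbounded:
  "mlocally_finite M d \<longleftrightarrow> (\<forall>S. mbounded S \<longrightarrow> finite S)"
  by (simp add: mlocally_finite_def mbounded_alt)

lemma (in Metric_space) closed_balls_nonempty:
  "A \<in> closed_balls M d \<Longrightarrow> A \<noteq> {}"
  by (force simp: closed_balls_def)

lemma (in Metric_space) closed_balls_mbounded:
  "A \<in> closed_balls M d \<Longrightarrow> mbounded A"
  by (auto simp: closed_balls_def mbounded_mcball)

end

theory Submission
  imports Defs
begin

text \<open>
  Singletons are balls of radius 0, and \<open>x \<mapsto> {x}\<close> is an isometric embedding, which gives one
  direction. Conversely, the members of a family of balls of finite Hausdorff diameter are all
  contained in one bounded set, and a finite set has only finitely many subsets.
\<close>

lemma hausdorff_mdist_singletons: "hausdorff_mdist d {x} {y} = d x y"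
  by (simp add: hausdorff_mdist_def)

context Metric_space
begin

lemma singleton_in_closed_balls:
  assumes "x \<in> M"
  shows "{x} \<in> closed_balls M d"
proof -
  \<comment> \<open>\<open>not_less\<close> is flipped so that \<open>d x y \<le> 0\<close> reads as
    \<open>\<not> 0 < d x y\<close>, which \<open>mdist_pos_less\<close> refutes for any other point
    \<open>y\<close>.\<close>
  have "{x} = mcball x 0"
    using assms by (auto dest: mdist_pos_less simp flip: not_less)
  then show ?thesis
    using assms unfolding closed_balls_def by blast
qed

text \<open>The left side is one of the values whose supremum is the second argument of
  \<open>max\<close>. The work lies in showing that these values are bounded above, without which
  the real \<open>SUP\<close> need not dominate them.\<close>

lemma INF_mdist_le_hausdorff_mdist:
  assumes "A \<subseteq> M" "A \<noteq> {}" "mbounded B" "b \<in> B"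
  shows "(INF a\<in>A. d a b) \<le> hausdorff_mdist d A B"
proof -
  obtain a where a: "a \<in> A"
    using assms by blast
  \<comment> \<open>A diameter bound for \<open>insert a B\<close> bounds the distances from the
    fixed point \<open>a\<close> to all of \<open>B\<close>, and each infimum over \<open>A\<close>
    is at most such a distance.\<close>
  have "mbounded (insert a B)"
    using assms a by (simp add: mbounded_insert subset_iff)
  then obtain C where C: "\<And>b. b \<in> B \<Longrightarrow> d a b \<le> C"
    unfolding mbounded_alt by blast
  have "(INF a\<in>A. d a b') \<le> C" if "b' \<in> B" for b'
  proof -
    have "bdd_below ((\<lambda>a. d a b') ` A)"
      by (rule bdd_belowI2[where m = 0]) (rule nonneg)
    then have "(INF a\<in>A. d a b') \<le> d a b'"
      using a by (rule cINF_lower)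
    also have "\<dots> \<le> C"
      using that by (rule C)
    finally show ?thesis .
  qed
  then have "bdd_above ((\<lambda>b. INF a\<in>A. d a b) ` B)"
    by (rule bdd_aboveI2)
  then have "(INF a\<in>A. d a b) \<le> (SUP b\<in>B. INF a\<in>A. d a b)"
    using assms(4) by (intro cSUP_upper)
  then show ?thesis
    by (simp add: hausdorff_mdist_def)
qed

text \<open>Fix one ball of the family. Every point of every member is within \<open>D + 1\<close>
  of some point of it, so one enlarged ball around its centre contains the whole union.\<close>

lemma mbounded_Union_closed_balls:
  assumes "\<S> \<subseteq> closed_balls M d"
    and D: "\<And>A B. \<lbrakk>A \<in> \<S>; B \<in> \<S>\<rbrakk> \<Longrightarrow> hausdorff_mdist d A B \<le> D"
  shows "mbounded (\<Union>\<S>)"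
proof (cases "\<S> = {}")
  case False
  then obtain c r where c: "c \<in> M" "0 \<le> r" "mcball c r \<in> \<S>"
    using assms(1) unfolding closed_balls_def by blast
  have "b \<in> mcball c (r + (D + 1))" if "B \<in> \<S>" "b \<in> B" for B b
  proof -
    have B: "mbounded B" "b \<in> M"
      using that assms(1) closed_balls_mbounded mbounded_subset_mspace by blast+
    have "(INF a\<in>mcball c r. d a b) \<le> hausdorff_mdist d (mcball c r) B"
      using c B that by (intro INF_mdist_le_hausdorff_mdist) auto
    \<comment> \<open>The infimum need not be attained. The slack of 1 makes the inequality strict,
      so that some point \<open>a\<close> of the reference ball satisfies
      \<open>d a b < D + 1\<close>.\<close>
    also have "\<dots> < D + 1"
      using D[OF c(3) that(1)] by simp
    finally obtain a where a: "a \<in> mcball c r" "d a b < D + 1"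
      using c by (subst (asm) cInf_less_iff) (auto intro!: bdd_belowI2[where m = 0])
    then have "d c b \<le> r + (D + 1)"
      using triangle[of c a b] B by auto
    then show ?thesis
      using B c by simp
  qed
  then show ?thesis
    unfolding mbounded_def by blast
qed simp

lemma mlocally_finite_closed_balls_iff:
  "mlocally_finite (closed_balls M d) (hausdorff_mdist d) \<longleftrightarrow> mlocally_finite M d"
proof
  assume fin: "mlocally_finite (closed_balls M d) (hausdorff_mdist d)"
  show "mlocally_finite M d"
    unfolding mlocally_finite_def
  proof (intro allI impI, elim conjE exE)
    fix S D
    assume S: "S \<subseteq> M" and D: "\<forall>x\<in>S. \<forall>y\<in>S. d x y \<le> D"
    have "(\<lambda>x. {x}) ` S \<subseteq> closed_balls M d"
      using S singleton_in_closed_balls by blast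
    moreover have "\<forall>A\<in>(\<lambda>x. {x}) ` S. \<forall>B\<in>(\<lambda>x. {x}) ` S. hausdorff_mdist d A B \<le> D"
      using D by (simp add: hausdorff_mdist_singletons)
    \<comment> \<open>\<open>conjI\<close> splits the premise of \<open>fin\<close> into inclusion
      and finite diameter, and \<open>exI\<close> supplies \<open>D\<close> as the diameter
      bound.\<close>
    ultimately have "finite ((\<lambda>x. {x}) ` S)"
      using fin[unfolded mlocally_finite_def, rule_format, OF conjI, OF _ exI[of _ D]] by simp
    then show "finite S"
      by (rule finite_imageD) simp
  qed
next
  assume fin: "mlocally_finite M d"
  show "mlocally_finite (closed_balls M d) (hausdorff_mdist d)"
    unfolding mlocally_finite_def
  proof (intro allI impI, elim conjE exE)
    fix \<S> D
    assume "\<S> \<subseteq> closed_balls M d"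
      and "\<forall>A\<in>\<S>. \<forall>B\<in>\<S>. hausdorff_mdist d A B \<le> D"
    then have "mbounded (\<Union>\<S>)"
      by (intro mbounded_Union_closed_balls) auto
    then have "finite (\<Union>\<S>)"
      using fin by (simp add: mlocally_finite_iff_mbounded)
    then show "finite \<S>"
      by (rule finite_UnionD)
  qed
qed

end

theorem theorem5p3:
  fixes X :: "'a set" and d :: "'a \<Rightarrow> 'a \<Rightarrow> real"
  assumes "Ultrametric_space X d"
  shows "mlocally_finite X d \<longleftrightarrow> mlocally_finite (closed_balls X d) (hausdorff_mdist d)"
proof -
  interpret Ultrametric_space X d
    by (fact assms)
  show ?thesis
    by (rule mlocally_finite_closed_balls_iff[symmetric])
qed

end
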